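(* Let $(M^4,g)$ be a Walker manifold of dimension $4$ and rank $2$, with null parallel distribution $\mathcal{D}$. Then the structure algebra $\mathfrak{g}_{\mathcal{D}}$ is abelian, i.e. $\mathfrak{g}_{\mathcal{D}}\cong\mathbb{R}^2$.
   Context: A pseudo-Riemannian manifold $(M^n,g)$ with Levi-Civita connection $\nabla$ is a Walker manifold of rank $r$ if there is a distribution $\mathcal{D}\subset TM$ of rank $r\le n/2$ which is parallel ($\nabla_XY\in\Gamma(\mathcal{D})$ for all $X\in\Gamma(TM)$, $Y\in\Gamma(\mathcal{D})$) and totally isotropic ($g(Y,Z)=0$ for all $Y,Z\in\Gamma(\mathcal{D})$). Structure algebra: the paper takes it that, since $\mathcal{D}$ is parallel, there is locally a basis $\{X_1,\dots,X_r\}$ of parallel sections of $\mathcal{D}$ ($\nabla_ZX_i=0$ for all $Z$); then $[X_i,X_j]=\sum_kc^k_{ij}X_k$ with real constants $c^k_{ij}$, and $\mathfrak{g}_{\mathcal{D}}$ is the Lie algebra on $\mathrm{Span}_{\mathbb{R}}\{X_1,\dots,X_r\}$ with this bracket. *)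

theory Defs
  imports "HOL-Analysis.Analysis" "HOL-Library.Function_Algebras"
begin

section \<open>Pointwise real vector space structure on functions\<close>

instantiation "fun" :: (type, real_vector) real_vector
begin

definition scaleR_fun :: "real \<Rightarrow> ('a \<Rightarrow> 'b) \<Rightarrow> 'a \<Rightarrow> 'b"
  where "scaleR_fun a f = (\<lambda>x. a *\<^sub>R f x)"

instance
  by standard (simp_all add: scaleR_fun_def fun_eq_iff algebra_simps)

end


section \<open>Smooth manifolds\<close>

primrec Ck_on :: "nat \<Rightarrow> (real^'n) set \<Rightarrow> (real^'n \<Rightarrow> 'b::real_normed_vector) \<Rightarrow> bool"
  where
    "Ck_on 0 S f \<longleftrightarrow> continuous_on S f"
  | "Ck_on (Suc k) S f \<longleftrightarrow>
       (\<forall>x\<in>S. f differentiable (at x)) \<and>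
       (\<forall>i. Ck_on k S (\<lambda>x. frechet_derivative f (at x) (axis i 1)))"

text \<open>Only used for open sets \<open>S\<close>.\<close>

definition Cinf_on :: "(real^'n) set \<Rightarrow> (real^'n \<Rightarrow> 'b::real_normed_vector) \<Rightarrow> bool"
  where "Cinf_on S f \<longleftrightarrow> (\<forall>k. Ck_on k S f)"

type_synonym ('a, 'n) chart = "'a set \<times> ('a \<Rightarrow> real^'n)"

definition chart_on :: "'a topology \<Rightarrow> ('a, 'n::finite) chart \<Rightarrow> bool"
  where "chart_on M = (\<lambda>(W, \<phi>). openin M W \<and> open (\<phi> ` W) \<and>
    homeomorphic_map (subtopology M W) (top_of_set (\<phi> ` W)) \<phi>)"

definition smooth_atlas :: "'a topology \<Rightarrow> ('a, 'n::finite) chart set \<Rightarrow> bool"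
  where "smooth_atlas M A \<longleftrightarrow>
    (\<forall>c\<in>A. chart_on M c) \<and>
    topspace M = (\<Union>(W, \<phi>)\<in>A. W) \<and>
    (\<forall>(W, \<phi>)\<in>A. \<forall>(W', \<psi>)\<in>A. Cinf_on (\<phi> ` (W \<inter> W')) (\<psi> \<circ> inv_into W \<phi>))"

definition smooth_manifold :: "'a topology \<Rightarrow> ('a, 'n::finite) chart set \<Rightarrow> bool"
  where "smooth_manifold M A \<longleftrightarrow>
    Hausdorff_space M \<and> second_countable M \<and> smooth_atlas M A"

definition smooth_fun_on ::
    "('a, 'n::finite) chart set \<Rightarrow> 'a set \<Rightarrow> ('a \<Rightarrow> real) \<Rightarrow> bool"
  where "smooth_fun_on A U f \<longleftrightarrow>
    (\<forall>(W, \<phi>)\<in>A. Cinf_on (\<phi> ` (W \<inter> U)) (f \<circ> inv_into W \<phi>))"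

definition smooth_near ::
    "'a topology \<Rightarrow> ('a, 'n::finite) chart set \<Rightarrow> 'a \<Rightarrow> ('a \<Rightarrow> real) \<Rightarrow> bool"
  where "smooth_near M A p f \<longleftrightarrow> (\<exists>U. openin M U \<and> p \<in> U \<and> smooth_fun_on A U f)"


section \<open>Tangent vectors, vector fields, Lie bracket\<close>

text \<open>
  A tangent vector at \<open>p\<close> is a derivation at \<open>p\<close> on germs of smooth functions, regarded as a
  functional on all functions that takes the value 0 on those that are not smooth near \<open>p\<close>.
\<close>

type_synonym 'a tvec = "('a \<Rightarrow> real) \<Rightarrow> real"

definition tangent_space ::
    "'a topology \<Rightarrow> ('a, 'n::finite) chart set \<Rightarrow> 'a \<Rightarrow> 'a tvec set"
  where "tangent_space M A p = {v.
    (\<forall>f g. smooth_near M A p f \<and> smooth_near M A p g \<longrightarrow>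
       v (f + g) = v f + v g \<and> v (f * g) = v f * g p + f p * v g) \<and>
    (\<forall>a f. smooth_near M A p f \<longrightarrow> v (a *\<^sub>R f) = a * v f) \<and>
    (\<forall>f g U. openin M U \<and> p \<in> U \<and> smooth_near M A p f \<and> (\<forall>q\<in>U. f q = g q) \<longrightarrow> v f = v g) \<and>
    (\<forall>f. \<not> smooth_near M A p f \<longrightarrow> v f = 0)}"

type_synonym 'a vfield = "'a \<Rightarrow> 'a tvec"

text \<open>
  A vector field on the open set \<open>U\<close> is extended by 0 outside \<open>U\<close>, so that the vector fields
  on \<open>U\<close> form a real vector space under the pointwise operations.
\<close>

definition vector_fields ::
    "'a topology \<Rightarrow> ('a, 'n::finite) chart set \<Rightarrow> 'a set \<Rightarrow> 'a vfield set"
  where "vector_fields M A U = {X.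
    (\<forall>p\<in>U. X p \<in> tangent_space M A p) \<and>
    (\<forall>p. p \<notin> U \<longrightarrow> X p = 0) \<and>
    (\<forall>V f. openin M V \<and> V \<subseteq> U \<and> smooth_fun_on A V f \<longrightarrow> smooth_fun_on A V (\<lambda>p. X p f))}"

definition restrict_field :: "'a set \<Rightarrow> 'a vfield \<Rightarrow> 'a vfield"
  where "restrict_field U X = (\<lambda>p. if p \<in> U then X p else 0)"

definition fun_times_field :: "('a \<Rightarrow> real) \<Rightarrow> 'a vfield \<Rightarrow> 'a vfield"
  where "fun_times_field f X = (\<lambda>p. f p *\<^sub>R X p)"

definition lie_bracket ::
    "'a topology \<Rightarrow> ('a, 'n::finite) chart set \<Rightarrow> 'a vfield \<Rightarrow> 'a vfield \<Rightarrow> 'a vfield"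
  where "lie_bracket M A X Y = (\<lambda>p f.
    if smooth_near M A p f then X p (\<lambda>q. Y q f) - Y p (\<lambda>q. X q f) else 0)"


section \<open>Pseudo-Riemannian metrics and the Levi-Civita connection\<close>

type_synonym 'a metric_tensor = "'a \<Rightarrow> 'a tvec \<Rightarrow> 'a tvec \<Rightarrow> real"

definition metric_index ::
    "'a topology \<Rightarrow> ('a, 'n::finite) chart set \<Rightarrow> 'a metric_tensor \<Rightarrow> 'a \<Rightarrow> nat"
  where "metric_index M A g p = (GREATEST k. \<exists>W. subspace W \<and> W \<subseteq> tangent_space M A p \<and>
    (\<forall>v\<in>W. v \<noteq> 0 \<longrightarrow> g p v v < 0) \<and> dim W = k)"

definition pseudo_riemannian_metric ::
    "'a topology \<Rightarrow> ('a, 'n::finite) chart set \<Rightarrow> 'a metric_tensor \<Rightarrow> bool"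
  where "pseudo_riemannian_metric M A g \<longleftrightarrow>
    (\<forall>p\<in>topspace M. \<forall>u\<in>tangent_space M A p. \<forall>v\<in>tangent_space M A p. \<forall>w\<in>tangent_space M A p. \<forall>a.
       g p (u + v) w = g p u w + g p v w \<and> g p (a *\<^sub>R u) w = a * g p u w \<and> g p u w = g p w u) \<and>
    (\<forall>p\<in>topspace M. \<forall>v\<in>tangent_space M A p.
       (\<forall>w\<in>tangent_space M A p. g p v w = 0) \<longrightarrow> v = 0) \<and>
    (\<forall>U. openin M U \<longrightarrow> (\<forall>X\<in>vector_fields M A U. \<forall>Y\<in>vector_fields M A U.
       smooth_fun_on A U (\<lambda>p. g p (X p) (Y p)))) \<and>
    (\<exists>\<nu>. \<forall>p\<in>topspace M. metric_index M A g p = \<nu>)"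

text \<open>
  A connection on \<open>M\<close> acts on vector fields over every open set, compatibly with restriction;
  \<open>nabla U X Y\<close> is the covariant derivative of \<open>Y\<close> along \<open>X\<close> over \<open>U\<close>. The member
  for \<open>U = topspace M\<close> is the usual operator on global vector fields.
\<close>

type_synonym 'a connection = "'a set \<Rightarrow> 'a vfield \<Rightarrow> 'a vfield \<Rightarrow> 'a vfield"

definition affine_connection ::
    "'a topology \<Rightarrow> ('a, 'n::finite) chart set \<Rightarrow> 'a connection \<Rightarrow> bool"
  where "affine_connection M A nabla \<longleftrightarrow>
    (\<forall>U. openin M U \<longrightarrow>
      (\<forall>X\<in>vector_fields M A U. \<forall>Y\<in>vector_fields M A U. \<forall>Z\<in>vector_fields M A U.
         nabla U X Y \<in> vector_fields M A U \<and>
         nabla U (X + Y) Z = nabla U X Z + nabla U Y Z \<and>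
         nabla U X (Y + Z) = nabla U X Y + nabla U X Z \<and>
         (\<forall>f. smooth_fun_on A U f \<longrightarrow>
            nabla U (fun_times_field f X) Y = fun_times_field f (nabla U X Y) \<and>
            nabla U X (fun_times_field f Y) =
              fun_times_field (\<lambda>p. X p f) Y + fun_times_field f (nabla U X Y))) \<and>
      (\<forall>V X Y. openin M V \<and> V \<subseteq> U \<and> X \<in> vector_fields M A U \<and> Y \<in> vector_fields M A U \<longrightarrow>
         restrict_field V (nabla U X Y) = nabla V (restrict_field V X) (restrict_field V Y)))"

definition torsion_free ::
    "'a topology \<Rightarrow> ('a, 'n::finite) chart set \<Rightarrow> 'a connection \<Rightarrow> bool"
  where "torsion_free M A nabla \<longleftrightarrow>
    (\<forall>U. openin M U \<longrightarrow> (\<forall>X\<in>vector_fields M A U. \<forall>Y\<in>vector_fields M A U.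
       nabla U X Y - nabla U Y X = lie_bracket M A X Y))"

definition metric_compatible ::
    "'a topology \<Rightarrow> ('a, 'n::finite) chart set \<Rightarrow> 'a metric_tensor \<Rightarrow> 'a connection \<Rightarrow> bool"
  where "metric_compatible M A g nabla \<longleftrightarrow>
    (\<forall>U. openin M U \<longrightarrow>
      (\<forall>X\<in>vector_fields M A U. \<forall>Y\<in>vector_fields M A U. \<forall>Z\<in>vector_fields M A U. \<forall>p\<in>U.
         X p (\<lambda>q. g q (Y q) (Z q)) = g p (nabla U X Y p) (Z p) + g p (Y p) (nabla U X Z p)))"

definition levi_civita_connection ::
    "'a topology \<Rightarrow> ('a, 'n::finite) chart set \<Rightarrow> 'a metric_tensor \<Rightarrow> 'a connection \<Rightarrow> bool"
  where "levi_civita_connection M A g nabla \<longleftrightarrow>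
    affine_connection M A nabla \<and> torsion_free M A nabla \<and> metric_compatible M A g nabla"


section \<open>Distributions and Walker manifolds\<close>

type_synonym 'a distribution = "'a \<Rightarrow> 'a tvec set"

definition sections ::
    "'a topology \<Rightarrow> ('a, 'n::finite) chart set \<Rightarrow> 'a set \<Rightarrow> 'a distribution \<Rightarrow> 'a vfield set"
  where "sections M A U D = {X \<in> vector_fields M A U. \<forall>p\<in>U. X p \<in> D p}"

definition local_frame ::
    "'a topology \<Rightarrow> ('a, 'n::finite) chart set \<Rightarrow> 'a set \<Rightarrow> nat \<Rightarrow> 'a distribution \<Rightarrow>
      (nat \<Rightarrow> 'a vfield) \<Rightarrow> bool"
  where "local_frame M A U r D X \<longleftrightarrow>
    (\<forall>i<r. X i \<in> sections M A U D) \<and>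
    (\<forall>p\<in>U. inj_on (\<lambda>i. X i p) {..<r} \<and> independent ((\<lambda>i. X i p) ` {..<r}) \<and>
       span ((\<lambda>i. X i p) ` {..<r}) = D p)"

definition smooth_distribution ::
    "'a topology \<Rightarrow> ('a, 'n::finite) chart set \<Rightarrow> nat \<Rightarrow> 'a distribution \<Rightarrow> bool"
  where "smooth_distribution M A r D \<longleftrightarrow>
    (\<forall>p\<in>topspace M. \<exists>U X. openin M U \<and> p \<in> U \<and> local_frame M A U r D X)"

definition parallel_distribution ::
    "'a topology \<Rightarrow> ('a, 'n::finite) chart set \<Rightarrow> 'a connection \<Rightarrow> 'a distribution \<Rightarrow> bool"
  where "parallel_distribution M A nabla D \<longleftrightarrow>
    (\<forall>X\<in>vector_fields M A (topspace M). \<forall>Y\<in>sections M A (topspace M) D.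
       nabla (topspace M) X Y \<in> sections M A (topspace M) D)"

definition totally_isotropic ::
    "'a topology \<Rightarrow> ('a, 'n::finite) chart set \<Rightarrow> 'a metric_tensor \<Rightarrow> 'a distribution \<Rightarrow> bool"
  where "totally_isotropic M A g D \<longleftrightarrow>
    (\<forall>Y\<in>sections M A (topspace M) D. \<forall>Z\<in>sections M A (topspace M) D.
       \<forall>p\<in>topspace M. g p (Y p) (Z p) = 0)"

definition walker_manifold ::
    "'a topology \<Rightarrow> ('a, 'n::finite) chart set \<Rightarrow> 'a metric_tensor \<Rightarrow> 'a connection \<Rightarrow>
      nat \<Rightarrow> 'a distribution \<Rightarrow> bool"
  where "walker_manifold M A g nabla r D \<longleftrightarrow>
    smooth_manifold M A \<and> pseudo_riemannian_metric M A g \<and>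
    levi_civita_connection M A g nabla \<and>
    2 * r \<le> CARD('n) \<and> smooth_distribution M A r D \<and>
    parallel_distribution M A nabla D \<and> totally_isotropic M A g D"

definition parallel_frame ::
    "'a topology \<Rightarrow> ('a, 'n::finite) chart set \<Rightarrow> 'a connection \<Rightarrow> 'a set \<Rightarrow> nat \<Rightarrow>
      'a distribution \<Rightarrow> (nat \<Rightarrow> 'a vfield) \<Rightarrow> bool"
  where "parallel_frame M A nabla U r D X \<longleftrightarrow>
    local_frame M A U r D X \<and> (\<forall>i<r. \<forall>Z\<in>vector_fields M A U. nabla U Z (X i) = 0)"


section \<open>Lie algebras and the structure algebra\<close>

text \<open>A real Lie algebra is given by its carrier, a subspace of the ambient type, and its bracket.\<close>

type_synonym 'v lie_data = "'v set \<times> ('v \<Rightarrow> 'v \<Rightarrow> 'v)"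

definition lie_algebra :: "'v::real_vector lie_data \<Rightarrow> bool"
  where "lie_algebra = (\<lambda>(L, br). subspace L \<and>
    (\<forall>x\<in>L. \<forall>y\<in>L. br x y \<in> L) \<and>
    (\<forall>x\<in>L. \<forall>y\<in>L. \<forall>z\<in>L. \<forall>a. br (a *\<^sub>R x + y) z = a *\<^sub>R br x z + br y z \<and>
       br z (a *\<^sub>R x + y) = a *\<^sub>R br z x + br z y) \<and>
    (\<forall>x\<in>L. br x x = 0) \<and>
    (\<forall>x\<in>L. \<forall>y\<in>L. \<forall>z\<in>L. br x (br y z) + br y (br z x) + br z (br x y) = 0))"

definition abelian_lie_algebra :: "'v::real_vector lie_data \<Rightarrow> bool"
  where "abelian_lie_algebra G \<longleftrightarrow>
    lie_algebra G \<and> (\<forall>x\<in>fst G. \<forall>y\<in>fst G. snd G x y = 0)"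

definition lie_algebra_isomorphic ::
    "'v::real_vector lie_data \<Rightarrow> 'w::real_vector lie_data \<Rightarrow> bool"
  where "lie_algebra_isomorphic G H \<longleftrightarrow>
    (\<exists>h. bij_betw h (fst G) (fst H) \<and>
      (\<forall>x\<in>fst G. \<forall>y\<in>fst G. \<forall>a. h (a *\<^sub>R x + y) = a *\<^sub>R h x + h y) \<and>
      (\<forall>x\<in>fst G. \<forall>y\<in>fst G. h (snd G x y) = snd H (h x) (h y)))"

definition structure_algebra ::
    "'a topology \<Rightarrow> ('a, 'n::finite) chart set \<Rightarrow> nat \<Rightarrow> (nat \<Rightarrow> 'a vfield) \<Rightarrow> 'a vfield lie_data"
  where "structure_algebra M A r X = (span (X ` {..<r}), lie_bracket M A)"

end

theory Submission
  imports Defs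
begin

text \<open>
  The Levi-Civita connection is torsion-free, so \<open>[Y, Z] = \<nabla>\<^bsub>Y\<^esub>Z - \<nabla>\<^bsub>Z\<^esub>Y\<close>, and both terms on the
  right vanish when \<open>Y\<close> and \<open>Z\<close> are parallel: parallel fields commute
  (\<open>lie_bracket_parallel\<close>). The structure algebra is spanned by two parallel fields. Parallelism
  is preserved by linear combinations with constant coefficients, because
  \<open>\<nabla>\<^bsub>Z\<^esub>(c Y) = (Z c) Y + c \<nabla>\<^bsub>Z\<^esub>Y\<close> and a derivation kills constants
  (\<open>parallel_fields_subspace\<close>); hence the bracket vanishes on the whole span.

  It remains to see that the span is two-dimensional. The members of a local frame over a
  nonempty set are independent over the reals, since already their values at a single point are
  (\<open>local_frame_independent\<close>). With the zero bracket, any linear bijection onto \<open>\<real>\<^sup>2\<close> is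
  an isomorphism of Lie algebras (\<open>abelian_structure_isomorphic\<close>).

  Vector fields are functions on germs here, so that they form a real vector space has to be
  derived from the closure of smooth functions under linear combinations. As derivatives of higher
  order involve values of the lower ones near a point, this uses that charts have open images.
\<close>

section \<open>Linear combinations of smooth functions\<close>

text \<open>
  Openness of \<open>S\<close> makes the full Frechet derivative at a point of \<open>S\<close> depend only on the values
  on \<open>S\<close>. This allows replacing the derivative of a combination by the combination of the
  derivatives, an equation valid on \<open>S\<close> only: elsewhere \<open>frechet_derivative\<close> may be
  arbitrary.
\<close>

lemma Ck_on_cong:
  assumes "open S" and "\<And>x. x \<in> S \<Longrightarrow> f x = h x" and "Ck_on k S f"
  shows "Ck_on k S h"
  using assms(2,3)
proof (induction k arbitrary: f h)
  case 0
  then show ?case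
    using continuous_on_cong by auto
next
  case (Suc k)
  have d: "h differentiable (at x)" if "x \<in> S" for x
  proof -
    have "(f has_derivative frechet_derivative f (at x)) (at x)"
      using Suc.prems(2) that by (simp add: frechet_derivative_works)
    then have "(h has_derivative frechet_derivative f (at x)) (at x)"
      by (rule has_derivative_transform_within_open[OF _ \<open>open S\<close> that Suc.prems(1)])
    then show ?thesis by (rule differentiableI)
  qed
  have "frechet_derivative f (at x) = frechet_derivative h (at x)" if "x \<in> S" for x
    using Suc.prems that by (intro frechet_derivative_transform_within_open[OF _ \<open>open S\<close>]) auto
  then have "Ck_on k S (\<lambda>x. frechet_derivative h (at x) (axis i 1))" for i
    using Suc.prems(2) by (auto intro: Suc.IH[of "\<lambda>x. frechet_derivative f (at x) (axis i 1)"])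
  with d show ?case by simp
qed

lemma Ck_on_linear_combination:
  assumes "open S" and "Ck_on k S f" and "Ck_on k S h"
  shows "Ck_on k S (\<lambda>x. a *\<^sub>R f x + b *\<^sub>R h x)"
  using assms(2,3)
proof (induction k arbitrary: f h)
  case 0
  then show ?case by (auto intro!: continuous_intros)
next
  case (Suc k)
  let ?l = "\<lambda>x. a *\<^sub>R f x + b *\<^sub>R h x"
  have D: "(?l has_derivative
      (\<lambda>v. a *\<^sub>R frechet_derivative f (at x) v + b *\<^sub>R frechet_derivative h (at x) v)) (at x)"
    if "x \<in> S" for x
    using Suc.prems that by (auto intro!: derivative_intros simp: frechet_derivative_works)
  have "Ck_on k S (\<lambda>x. frechet_derivative ?l (at x) (axis i 1))" for i
  proof (rule Ck_on_cong[OF \<open>open S\<close>])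
    show "Ck_on k S (\<lambda>x. a *\<^sub>R frechet_derivative f (at x) (axis i 1)
        + b *\<^sub>R frechet_derivative h (at x) (axis i 1))"
      using Suc.prems by (intro Suc.IH) simp_all
  qed (simp add: frechet_derivative_at[OF D, symmetric])
  then show ?case
    using D by (auto simp: differentiable_def)
qed

lemma Ck_on_const: "Ck_on k S (\<lambda>x. c)"
  by (induction k arbitrary: c) auto

lemma smooth_fun_on_const: "smooth_fun_on A U (\<lambda>p. c)"
  by (auto simp: smooth_fun_on_def Cinf_on_def comp_def Ck_on_const)

lemma open_chart_image:
  assumes "chart_on M (W, \<phi>)" and "openin M V"
  shows "open (\<phi> ` (W \<inter> V))"
proof -
  have "open_map (subtopology M W) (top_of_set (\<phi> ` W)) \<phi>" and "open (\<phi> ` W)"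
    using assms(1) by (auto simp: chart_on_def homeomorphic_imp_open_map)
  moreover have "openin (subtopology M W) (W \<inter> V)"
    using assms(2) by (auto simp: openin_subtopology)
  ultimately show ?thesis
    by (auto simp: open_map_def dest: openin_open_trans)
qed

lemma smooth_fun_on_linear_combination:
  assumes "smooth_atlas M A" and "openin M V" and "smooth_fun_on A V f" and "smooth_fun_on A V h"
  shows "smooth_fun_on A V (\<lambda>p. a * f p + b * h p)"
  unfolding smooth_fun_on_def
proof clarify
  fix W \<phi> assume W: "(W, \<phi>) \<in> A"
  then have "open (\<phi> ` (W \<inter> V))"
    using assms by (intro open_chart_image) (auto simp: smooth_atlas_def)
  moreover have "Cinf_on (\<phi> ` (W \<inter> V)) (f \<circ> inv_into W \<phi>)"
    and "Cinf_on (\<phi> ` (W \<inter> V)) (h \<circ> inv_into W \<phi>)"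
    using assms W by (auto simp: smooth_fun_on_def)
  ultimately show "Cinf_on (\<phi> ` (W \<inter> V)) ((\<lambda>p. a * f p + b * h p) \<circ> inv_into W \<phi>)"
    using Ck_on_linear_combination[of _ _ "f \<circ> inv_into W \<phi>" "h \<circ> inv_into W \<phi>" a b]
    by (auto simp: Cinf_on_def comp_def)
qed

section \<open>The vector space of vector fields\<close>

lemma tangent_vector_germ:
  assumes "v \<in> tangent_space M A p" and "openin M U" "p \<in> U" "smooth_near M A p f"
    and "\<forall>q\<in>U. f q = h q"
  shows "v f = v h"
  using assms(1)[unfolded tangent_space_def mem_Collect_eq,
      THEN conjunct2, THEN conjunct2, THEN conjunct1, rule_format, of U f h] assms(2-5)
  by simp

text \<open>
  All four clauses of the definition of a tangent vector are linear in the vector, including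
  the default value 0 on functions that are not smooth near the point.
\<close>

lemma tangent_space_linear_combination:
  assumes "u \<in> tangent_space M A p" and "v \<in> tangent_space M A p"
  shows "a *\<^sub>R u + b *\<^sub>R v \<in> tangent_space M A p"
proof -
  show ?thesis
    unfolding tangent_space_def
  proof (intro CollectI conjI allI impI)
    fix f h U
    assume "openin M U \<and> p \<in> U \<and> smooth_near M A p f \<and> (\<forall>q\<in>U. f q = h q)"
    then show "(a *\<^sub>R u + b *\<^sub>R v) f = (a *\<^sub>R u + b *\<^sub>R v) h"
      using tangent_vector_germ[OF assms(1), of U f h] tangent_vector_germ[OF assms(2), of U f h]
      by (simp add: scaleR_fun_def)
  qed (use assms in \<open>simp_all add: tangent_space_def scaleR_fun_def algebra_simps\<close>)
qed

lemma zero_in_tangent_space: "0 \<in> tangent_space M A p"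
  by (simp add: tangent_space_def)

text \<open>The Leibniz rule for \<open>1 = 1 * 1\<close> gives \<open>v 1 = 2 * v 1\<close>.\<close>

lemma tangent_vector_const:
  fixes M :: "'a topology"
  assumes "v \<in> tangent_space M A p" and "p \<in> topspace M"
  shows "v (\<lambda>q. c) = 0"
proof -
  have 1: "smooth_near M A p 1"
    using assms(2) smooth_fun_on_const[of A "topspace M" 1]
    unfolding smooth_near_def one_fun_def by blast
  have "v (1 * 1) = v 1 * 1 p + 1 p * v 1"
    using assms(1) 1 unfolding tangent_space_def by blast
  moreover have "1 * 1 = (1 :: 'a \<Rightarrow> real)"
    by (simp add: fun_eq_iff)
  ultimately have "v 1 = 0"
    by simp
  moreover have "v (c *\<^sub>R 1) = c * v 1"
    using assms(1) 1 unfolding tangent_space_def by blast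
  moreover have "(\<lambda>q :: 'a. c) = c *\<^sub>R 1"
    by (simp add: scaleR_fun_def fun_eq_iff one_fun_def)
  ultimately show ?thesis by simp
qed

lemma vector_fields_linear_combination:
  fixes M :: "'a topology"
  assumes "smooth_atlas M A" and "X \<in> vector_fields M A U" and "Y \<in> vector_fields M A U"
  shows "a *\<^sub>R X + b *\<^sub>R Y \<in> vector_fields M A U"
proof -
  have "smooth_fun_on A V (\<lambda>p. a * X p f + b * Y p f)"
    if "openin M V" "V \<subseteq> U" "smooth_fun_on A V f" for V f
    using assms that by (intro smooth_fun_on_linear_combination) (auto simp: vector_fields_def)
  moreover have "(a *\<^sub>R X + b *\<^sub>R Y) p = a *\<^sub>R X p + b *\<^sub>R Y p" for p
    by (simp add: scaleR_fun_def)
  moreover have "(a *\<^sub>R u + b *\<^sub>R v) f = a * u f + b * v f" for u v :: "'a tvec" and f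
    by (simp add: scaleR_fun_def)
  ultimately show ?thesis
    using assms(2,3) unfolding vector_fields_def
    by (simp add: tangent_space_linear_combination)
qed

lemma zero_in_vector_fields: "0 \<in> vector_fields M A U"
  by (simp add: vector_fields_def zero_in_tangent_space smooth_fun_on_const)

section \<open>Parallel fields\<close>

lemma affine_connection_add:
  assumes "affine_connection M A nabla" and "openin M U"
    and "Z \<in> vector_fields M A U" and "Y \<in> vector_fields M A U" and "Y' \<in> vector_fields M A U"
  shows "nabla U Z (Y + Y') = nabla U Z Y + nabla U Z Y'"
  using assms(1)[unfolded affine_connection_def, rule_format, OF assms(2), THEN conjunct1,
      rule_format, OF assms(3-5)]
  by blast

lemma affine_connection_Leibniz:
  assumes "affine_connection M A nabla" and "openin M U"
    and "Z \<in> vector_fields M A U" and "Y \<in> vector_fields M A U" and "smooth_fun_on A U f"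
  shows "nabla U Z (fun_times_field f Y) =
    fun_times_field (\<lambda>p. Z p f) Y + fun_times_field f (nabla U Z Y)"
  using assms(1)[unfolded affine_connection_def, rule_format, OF assms(2), THEN conjunct1,
      rule_format, OF assms(3,4,4)] assms(5)
  by blast

definition parallel_fields ::
    "'a topology \<Rightarrow> ('a, 'n::finite) chart set \<Rightarrow> 'a connection \<Rightarrow> 'a set \<Rightarrow> 'a vfield set"
  where "parallel_fields M A nabla U =
    {Y \<in> vector_fields M A U. \<forall>Z\<in>vector_fields M A U. nabla U Z Y = 0}"

lemma lie_bracket_parallel:
  assumes "torsion_free M A nabla" and "openin M U"
    and "Y \<in> parallel_fields M A nabla U" and "Z \<in> parallel_fields M A nabla U"
  shows "lie_bracket M A Y Z = 0"
proof -
  have "lie_bracket M A Y Z = nabla U Y Z - nabla U Z Y"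
    using assms(1)[unfolded torsion_free_def, rule_format, of U Y Z] assms(2-4)
    by (simp add: parallel_fields_def)
  also have "\<dots> = 0"
    using assms(3,4) by (simp add: parallel_fields_def)
  finally show ?thesis .
qed

text \<open>
  A connection is given as homogeneous only through the Leibniz rule, so the scalar is regarded as
  a constant function, whose derivative along any field vanishes.
\<close>

lemma parallel_scaleR:
  fixes M :: "'a topology"
  assumes "smooth_atlas M A" and "affine_connection M A nabla" and "openin M U"
    and "Y \<in> parallel_fields M A nabla U"
  shows "c *\<^sub>R Y \<in> parallel_fields M A nabla U"
proof -
  have Y: "Y \<in> vector_fields M A U"
    using assms(4) by (simp add: parallel_fields_def)
  have "nabla U Z (c *\<^sub>R Y) = 0" if Z: "Z \<in> vector_fields M A U" for Z
  proof -
    have Zc: "Z p (\<lambda>q. c) = 0" for p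
    proof (cases "p \<in> U")
      case True
      with Z assms(3) show ?thesis
        by (intro tangent_vector_const[of _ M A p])
           (auto simp: vector_fields_def dest: openin_subset)
    next
      case False
      with Z show ?thesis by (simp add: vector_fields_def)
    qed
    have "nabla U Z (fun_times_field (\<lambda>q. c) Y) =
        fun_times_field (\<lambda>p. Z p (\<lambda>q. c)) Y + fun_times_field (\<lambda>q. c) (nabla U Z Y)"
      using assms(2,3) Z Y smooth_fun_on_const by (rule affine_connection_Leibniz)
    moreover have "nabla U Z Y = 0"
      using assms(4) Z by (simp add: parallel_fields_def)
    moreover have "fun_times_field (\<lambda>q. k) T = k *\<^sub>R T" for k and T :: "'a vfield"
      by (simp add: fun_times_field_def scaleR_fun_def)
    ultimately show ?thesis
      by (simp add: Zc)
  qed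
  then show ?thesis
    using vector_fields_linear_combination[OF assms(1) Y Y, of c 0]
    by (simp add: parallel_fields_def)
qed

lemma parallel_fields_subspace:
  assumes "smooth_atlas M A" and "affine_connection M A nabla" and "openin M U"
  shows "subspace (parallel_fields M A nabla U)"
proof (rule subspaceI)
  note add = affine_connection_add[OF assms(2,3)]
  show "0 \<in> parallel_fields M A nabla U"
    using zero_in_vector_fields[of M A U] add[of _ 0 0] by (simp add: parallel_fields_def)
  show "Y + Y' \<in> parallel_fields M A nabla U"
    if "Y \<in> parallel_fields M A nabla U" "Y' \<in> parallel_fields M A nabla U" for Y Y'
    using that vector_fields_linear_combination[OF assms(1), of Y U Y' 1 1] add
    by (simp add: parallel_fields_def)
  show "c *\<^sub>R Y \<in> parallel_fields M A nabla U"
    if "Y \<in> parallel_fields M A nabla U" for c Y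
    using assms that by (rule parallel_scaleR)
qed

section \<open>Dimension of the structure algebra\<close>

text \<open>
  Applying \<open>f\<close> to a linear relation in \<open>B\<close> gives one in \<open>f ` B\<close>. Its coefficients are the
  same, as \<open>f\<close> merges no two members of \<open>B\<close>.
\<close>

lemma independent_if_image_independent:
  assumes "linear f" and "inj_on f B" and "independent (f ` B)"
  shows "independent B"
  unfolding independent_explicit_finite_subsets
proof (intro allI impI ballI)
  fix T u x
  assume T: "T \<subseteq> B" "finite T" and 0: "(\<Sum>v\<in>T. u v *\<^sub>R v) = 0" and x: "x \<in> T"
  have inj: "inj_on f T"
    using assms(2) T(1) by (rule inj_on_subset)
  have "(\<Sum>w\<in>f ` T. u (inv_into T f w) *\<^sub>R w) = (\<Sum>v\<in>T. u v *\<^sub>R f v)"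
    using inj by (simp add: sum.reindex)
  also have "\<dots> = f (\<Sum>v\<in>T. u v *\<^sub>R v)"
    using assms(1) by (simp add: linear_sum linear_scale)
  finally have "(\<Sum>w\<in>f ` T. u (inv_into T f w) *\<^sub>R w) = 0"
    using 0 assms(1) by (simp add: linear_0)
  then have "u (inv_into T f (f x)) = 0"
    using assms(3) T x unfolding independent_explicit_finite_subsets
    by (meson finite_imageI image_eqI image_mono)
  then show "u x = 0"
    using inj x by simp
qed

text \<open>Evaluation at \<open>p\<close> is linear, so a relation between the fields would hold between their values.\<close>

lemma local_frame_independent:
  assumes "local_frame M A U r D X" and "p \<in> U"
  shows "independent (X ` {..<r})" and "inj_on X {..<r}"
proof -
  have inj: "inj_on (\<lambda>i. X i p) {..<r}" and ind: "independent ((\<lambda>i. X i p) ` {..<r})"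
    using assms by (auto simp: local_frame_def)
  show "inj_on X {..<r}"
    using inj by (auto simp: inj_on_def)
  show "independent (X ` {..<r})"
  proof (rule independent_if_image_independent[where f = "\<lambda>Y. Y p"])
    show "linear (\<lambda>Y. (Y :: 'a vfield) p)"
      by (rule linearI) (simp_all add: scaleR_fun_def)
    show "inj_on (\<lambda>Y. Y p) (X ` {..<r})"
      using inj by (auto simp: inj_on_def)
    show "independent ((\<lambda>Y. Y p) ` X ` {..<r})"
      using ind by (simp add: image_image)
  qed
qed

lemma linear_iso_of_card_eq_DIM:
  fixes B :: "'v::real_vector set"
  assumes "independent B" and "finite B" and "card B = DIM('e::euclidean_space)"
  obtains h :: "'v \<Rightarrow> 'e::euclidean_space" where "linear h" and "bij_betw h (span B) UNIV"
proof -
  obtain f :: "'v \<Rightarrow> 'e" where f: "bij_betw f B Basis"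
    using finite_same_card_bij[OF assms(2) finite_Basis assms(3)] by blast
  obtain h :: "'v \<Rightarrow> 'e" where h: "linear h" "\<forall>x\<in>B. h x = f x"
    using linear_independent_extend[OF assms(1), of f] by blast
  have img: "h ` B = Basis" and "inj_on h B"
    using f h(2) by (auto simp: bij_betw_def cong: image_cong inj_on_cong)
  then have "inj_on h (span B)"
    using h(1) by (intro linear_inj_on_span_independent_image) (simp_all add: independent_Basis)
  moreover have "h ` span B = UNIV"
    using img h(1) by (simp add: linear_span_image[symmetric])
  ultimately show thesis
    using h(1) that by (simp add: bij_betw_def)
qed

lemma abelian_lie_algebra_if_bracket_zero:
  assumes "subspace L" and "\<And>x y. x \<in> L \<Longrightarrow> y \<in> L \<Longrightarrow> br x y = 0"
  shows "abelian_lie_algebra (L, br)"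
proof -
  have "0 \<in> L" and "\<And>a x y. x \<in> L \<Longrightarrow> y \<in> L \<Longrightarrow> a *\<^sub>R x + y \<in> L"
    using assms(1) by (auto intro: subspace_0 subspace_add subspace_scale)
  with assms show ?thesis
    by (simp add: abelian_lie_algebra_def lie_algebra_def)
qed

lemma abelian_structure_isomorphic:
  fixes B :: "'v::real_vector set"
  assumes "independent B" and "finite B" and "card B = DIM('e::euclidean_space)"
    and "\<And>x y. x \<in> span B \<Longrightarrow> y \<in> span B \<Longrightarrow> br x y = 0"
  shows "lie_algebra_isomorphic (span B, br) ((UNIV :: 'e::euclidean_space set), (\<lambda>x y. 0))"
proof -
  obtain h :: "'v \<Rightarrow> 'e" where "linear h" and "bij_betw h (span B) UNIV"
    using linear_iso_of_card_eq_DIM[OF assms(1-3)] .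
  then show ?thesis
    unfolding lie_algebra_isomorphic_def
    by (intro exI[of _ h]) (simp add: assms(4) linear_0 linear_add linear_scale)
qed

theorem mainTheorem5:
  fixes M :: "'a topology" and A :: "('a, 4) chart set"
    and g :: "'a metric_tensor" and nabla :: "'a connection"
    and D :: "'a distribution" and U :: "'a set" and X :: "nat \<Rightarrow> 'a vfield"
  assumes "walker_manifold M A g nabla 2 D"
    and "openin M U" and "U \<noteq> {}"
    and "parallel_frame M A nabla U 2 D X"
  shows "abelian_lie_algebra (structure_algebra M A 2 X) \<and>
    lie_algebra_isomorphic (structure_algebra M A 2 X) ((UNIV :: (real^2) set), (\<lambda>x y. 0))"
proof -
  have M: "smooth_atlas M A" "affine_connection M A nabla" "torsion_free M A nabla"
    using assms(1)
    by (auto simp: walker_manifold_def smooth_manifold_def levi_civita_connection_def)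
  have frame: "local_frame M A U 2 D X"
    using assms(4) by (simp add: parallel_frame_def)
  have "X ` {..<2} \<subseteq> parallel_fields M A nabla U"
    using assms(4)
    by (auto simp: parallel_frame_def local_frame_def sections_def parallel_fields_def)
  then have "span (X ` {..<2}) \<subseteq> parallel_fields M A nabla U"
    using parallel_fields_subspace[OF M(1,2) assms(2)] by (rule span_minimal)
  then have bracket: "lie_bracket M A Y Z = 0"
    if "Y \<in> span (X ` {..<2})" "Z \<in> span (X ` {..<2})" for Y Z
    using that lie_bracket_parallel[OF M(3) assms(2)] by blast
  obtain p where "p \<in> U"
    using assms(3) by blast
  note ind = local_frame_independent[OF frame \<open>p \<in> U\<close>]
  have "card (X ` {..<2}) = DIM(real^2)"
    using ind(2) by (simp add: card_image)
  then show ?thesis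
    unfolding structure_algebra_def
    using ind(1) bracket
    by (intro conjI abelian_lie_algebra_if_bracket_zero abelian_structure_isomorphic) auto
qed

end
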